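(* Let $m\ge 1$ be an integer and $q\in(0,1)$. Let $H_1,\dots,H_m$ be null hypotheses, let $I_0\subseteq\{1,\dots,m\}$ be the set of indices of the true null hypotheses, and let $P_1,\dots,P_m$ be the corresponding $[0,1]$-valued random $p$-values. Assume that $P_1,\dots,P_m$ are mutually independent and that $P_i$ is distributed as $U(0,1)$ for every $i\in I_0$. Let $0\le\alpha_1\le\cdots\le\alpha_m<1$ be constants satisfying $$\frac{\alpha_i}{1-\alpha_i}\le\frac{iq}{m+1-i},\qquad i=1,\dots,m.$$ Then the step-down procedure with critical values $\alpha_1,\dots,\alpha_m$ controls the false discovery rate at $q$, that is, $$\mathrm{FDR}=E\left[\frac{V}{R}\,I_{\{R>0\}}\right]\le q,$$ where $R$ is the number of null hypotheses rejected by the procedure and $V$ is the number of true null hypotheses rejected by it.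
   Context: Step-down procedure with critical values $\alpha_1\le\cdots\le\alpha_m$: sort the $p$-values as $P_{(1)}\le\cdots\le P_{(m)}$ and let $H_{(i)}$ be the null hypothesis corresponding to $P_{(i)}$. Let $k=\max\{1\le i\le m: P_{(j)}\le\alpha_j \text{ for all } j=1,\dots,i\}$. If such a $k$ exists, reject the $k$ hypotheses $H_{(1)},\dots,H_{(k)}$; otherwise reject no hypothesis. The total number of rejected hypotheses is $R$, and $V$ is the number of rejected hypotheses $H_i$ with $i\in I_0$. The quantity $\frac{V}{R}I_{\{R>0\}}$ is understood to be $0$ when $R=0$. No assumption is made on the marginal distributions of $P_i$ for $i\notin I_0$. *)

theory Defs
  imports "HOL-Probability.Probability"
begin

text \<open>
  Hypotheses are identified with their indices \<open>1, \<dots>, m\<close>; \<open>p i\<close> is the p-value of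
  hypothesis \<open>i\<close>, and only the values of \<open>p\<close> and \<open>\<alpha>\<close> on \<open>{1..m}\<close> matter.

  \<open>ordered_hyp m p i\<close> is the index of \<open>H\<^sub>(\<^sub>i\<^sub>)\<close> for \<open>i \<in> {1..m}\<close>. As \<open>sort_key\<close> is stable, ties
  between p-values are broken in favour of the smaller index. This convention does not affect
  the set of rejected hypotheses when \<open>\<alpha>\<close> is nondecreasing: if \<open>P\<^sub>(\<^sub>k\<^sub>+\<^sub>1\<^sub>) = P\<^sub>(\<^sub>k\<^sub>)\<close> and
  \<open>P\<^sub>(\<^sub>k\<^sub>) \<le> \<alpha>\<^sub>k\<close>, then also \<open>P\<^sub>(\<^sub>k\<^sub>+\<^sub>1\<^sub>) \<le> \<alpha>\<^sub>k\<^sub>+\<^sub>1\<close>, so tied hypotheses are rejected together.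
\<close>

definition ordered_hyp :: "nat \<Rightarrow> (nat \<Rightarrow> real) \<Rightarrow> nat \<Rightarrow> nat" where
  "ordered_hyp m p i = sort_key p [1..<Suc m] ! (i - 1)"

definition ordered_pval :: "nat \<Rightarrow> (nat \<Rightarrow> real) \<Rightarrow> nat \<Rightarrow> real" where
  "ordered_pval m p i = p (ordered_hyp m p i)"

definition stepdown_indices :: "nat \<Rightarrow> (nat \<Rightarrow> real) \<Rightarrow> (nat \<Rightarrow> real) \<Rightarrow> nat set" where
  "stepdown_indices m \<alpha> p = {i \<in> {1..m}. \<forall>j\<in>{1..i}. ordered_pval m p j \<le> \<alpha> j}"

definition stepdown_rejected :: "nat \<Rightarrow> (nat \<Rightarrow> real) \<Rightarrow> (nat \<Rightarrow> real) \<Rightarrow> nat set" where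
  "stepdown_rejected m \<alpha> p =
     (if stepdown_indices m \<alpha> p = {} then {}
      else ordered_hyp m p ` {1..Max (stepdown_indices m \<alpha> p)})"

definition num_rejected :: "nat \<Rightarrow> (nat \<Rightarrow> real) \<Rightarrow> (nat \<Rightarrow> real) \<Rightarrow> nat" where
  "num_rejected m \<alpha> p = card (stepdown_rejected m \<alpha> p)"

definition num_true_rejected ::
  "nat \<Rightarrow> (nat \<Rightarrow> real) \<Rightarrow> nat set \<Rightarrow> (nat \<Rightarrow> real) \<Rightarrow> nat" where
  "num_true_rejected m \<alpha> I0 p = card (stepdown_rejected m \<alpha> p \<inter> I0)"

definition stepdown_FDR ::
  "'a measure \<Rightarrow> nat \<Rightarrow> (nat \<Rightarrow> real) \<Rightarrow> nat set \<Rightarrow> (nat \<Rightarrow> 'a \<Rightarrow> real) \<Rightarrow> real" where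
  "stepdown_FDR M m \<alpha> I0 P =
     (\<integral>\<omega>. (let R = num_rejected m \<alpha> (\<lambda>i. P i \<omega>);
               V = num_true_rejected m \<alpha> I0 (\<lambda>i. P i \<omega>)
           in if R > 0 then real V / real R else 0) \<partial>M)"

end

theory Submission
  imports Defs
begin

text \<open>
  Fix a true null \<open>i\<close> and let \<open>U\<close> be the number of rejections when the step-down procedure, with
  the critical values \<open>\<alpha>\<^sub>1, \<dots>, \<alpha>\<^sub>m\<^sub>-\<^sub>1\<close>, is run on all hypotheses except \<open>i\<close>. The fate of \<open>i\<close> in
  the full procedure is decided by comparing \<open>P\<^sub>i\<close> with the single critical value \<open>\<alpha>\<^sub>U\<^sub>+\<^sub>1\<close>:

    \<^item> if \<open>P\<^sub>i \<le> \<alpha>\<^sub>U\<^sub>+\<^sub>1\<close>, then at least \<open>U + 1\<close> hypotheses are rejected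
      (\<open>Suc_stop_count_remove_le\<close>);
    \<^item> if \<open>P\<^sub>i > \<alpha>\<^sub>U\<^sub>+\<^sub>1\<close>, then \<open>i\<close> is not rejected and exactly \<open>U\<close> hypotheses are
      (\<open>not_rejected_if_gt\<close>, \<open>stop_count_remove_eq\<close>).

  So the contribution of \<open>i\<close> to \<open>V / R\<close> is at most \<open>1 / (U + 1)\<close> on \<open>{P\<^sub>i \<le> \<alpha>\<^sub>U\<^sub>+\<^sub>1}\<close> and zero
  elsewhere. As \<open>U\<close> depends only on the other p-values, it is independent of the uniform variable
  \<open>P\<^sub>i\<close>, and \<open>P\<^sub>i\<close> can be integrated out
  (\<open>expectation_below_independent_threshold\<close>): the expected contribution is at most
  \<open>E[\<alpha>\<^sub>U\<^sub>+\<^sub>1 / (U + 1)]\<close>. The condition on the critical values, at index \<open>U + 1\<close>, reads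
  \<open>\<alpha>\<^sub>U\<^sub>+\<^sub>1 / (U + 1) \<le> q (1 - \<alpha>\<^sub>U\<^sub>+\<^sub>1) / (m - U)\<close>. Putting \<open>P\<^sub>i\<close> back, \<open>1 - \<alpha>\<^sub>U\<^sub>+\<^sub>1\<close> is the
  conditional probability of \<open>P\<^sub>i > \<alpha>\<^sub>U\<^sub>+\<^sub>1\<close>, and on that event \<open>U = R\<close> and \<open>i\<close> is accepted.
  The bound on the contribution of \<open>i\<close> is therefore at most \<open>q\<close> times the expectation of
  \<open>1 / (m - R)\<close> on the event that \<open>i\<close> is accepted. Summed over the true nulls, these random
  variables give the number of accepted true nulls divided by the number \<open>m - R\<close> of all accepted
  hypotheses, which is at most \<open>1\<close> (\<open>accepted_true_null_proportion_le\<close>).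
\<close>

section \<open>The number of rejections as a counting functional\<close>

text \<open>
  Since \<open>P\<^sub>(\<^sub>k\<^sub>+\<^sub>1\<^sub>) \<le> \<alpha>\<^sub>k\<^sub>+\<^sub>1\<close> says that more than \<open>k\<close> p-values are at most \<open>\<alpha>\<^sub>k\<^sub>+\<^sub>1\<close>, the
  step-down procedure on the hypotheses \<open>J\<close> stops at the first \<open>k\<close> for which this fails. This
  form avoids sorting, makes sense for every finite \<open>J\<close>, and is visibly measurable. At \<open>k = card J\<close>
  the condition fails whatever the value of \<open>\<alpha>\<close> is there, so the minimum exists.
\<close>

definition stop_count :: "'b set \<Rightarrow> (nat \<Rightarrow> real) \<Rightarrow> ('b \<Rightarrow> real) \<Rightarrow> nat" where
  "stop_count J \<alpha> p = (LEAST k. card {j \<in> J. p j \<le> \<alpha> (Suc k)} \<le> k)"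

lemma card_le_stop_count:
  assumes "finite J"
  shows "card {j \<in> J. p j \<le> \<alpha> (Suc (stop_count J \<alpha> p))} \<le> stop_count J \<alpha> p"
  unfolding stop_count_def
proof (rule LeastI)
  show "card {j \<in> J. p j \<le> \<alpha> (Suc (card J))} \<le> card J"
    by (rule card_mono) (use assms in auto)
qed

lemma stop_count_le_card:
  assumes "finite J"
  shows "stop_count J \<alpha> p \<le> card J"
  unfolding stop_count_def
  by (rule Least_le, rule card_mono) (use assms in auto)

lemma less_card_if_less_stop_count:
  "k < stop_count J \<alpha> p \<Longrightarrow> k < card {j \<in> J. p j \<le> \<alpha> (Suc k)}"
  unfolding stop_count_def by (drule not_less_Least) simp

lemma le_stop_count_iff:
  assumes "finite J"
  shows "n \<le> stop_count J \<alpha> p \<longleftrightarrow> (\<forall>k<n. k < card {j \<in> J. p j \<le> \<alpha> (Suc k)})"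
proof
  assume "n \<le> stop_count J \<alpha> p"
  then show "\<forall>k<n. k < card {j \<in> J. p j \<le> \<alpha> (Suc k)}"
    by (auto intro: less_card_if_less_stop_count)
next
  assume "\<forall>k<n. k < card {j \<in> J. p j \<le> \<alpha> (Suc k)}"
  then have "\<not> stop_count J \<alpha> p < n"
    using card_le_stop_count[OF assms, of p \<alpha>] by (auto simp: not_less[symmetric])
  then show "n \<le> stop_count J \<alpha> p" by simp
qed

lemma stop_count_eq_iff:
  assumes "finite J"
  shows "stop_count J \<alpha> p = n \<longleftrightarrow>
    card {j \<in> J. p j \<le> \<alpha> (Suc n)} \<le> n \<and> (\<forall>k<n. k < card {j \<in> J. p j \<le> \<alpha> (Suc k)})"
proof -
  have "stop_count J \<alpha> p = n \<longleftrightarrow> n \<le> stop_count J \<alpha> p \<and> \<not> Suc n \<le> stop_count J \<alpha> p"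
    by auto
  then show ?thesis
    by (auto simp: le_stop_count_iff[OF assms] All_less_Suc not_less)
qed

section \<open>Translation of the sorted procedure\<close>

lemma sorted_nth_le_iff_less_length_filter:
  fixes t :: "'b::linorder"
  assumes "sorted ys" "k < length ys"
  shows "ys ! k \<le> t \<longleftrightarrow> k < length (filter (\<lambda>y. y \<le> t) ys)"
  using assms
proof (induction ys arbitrary: k)
  case (Cons y ys)
  show ?case
  proof (cases "y \<le> t")
    case True
    then show ?thesis using Cons by (cases k) auto
  next
    case False
    then have "filter (\<lambda>y. y \<le> t) (y # ys) = []"
      using Cons.prems(1) by (auto simp: filter_empty_conv)
    moreover have "y \<le> (y # ys) ! k"
      using Cons.prems by (cases k) auto
    ultimately show ?thesis using False by (auto simp del: filter.simps)
  qed
qed simp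

lemma ordered_pval_le_iff:
  assumes "k < m"
  shows "ordered_pval m p (Suc k) \<le> t \<longleftrightarrow> k < card {j \<in> {1..m}. p j \<le> t}"
proof -
  let ?xs = "sort_key p [1..<Suc m]"
  have "length (filter (\<lambda>y. y \<le> t) (map p ?xs)) = length (filter (\<lambda>j. p j \<le> t) ?xs)"
    by (simp add: filter_map o_def)
  also have "\<dots> = card (set (filter (\<lambda>j. p j \<le> t) ?xs))"
    by (rule distinct_card[symmetric]) simp
  also have "set (filter (\<lambda>j. p j \<le> t) ?xs) = {j \<in> {1..m}. p j \<le> t}"
    by auto
  finally show ?thesis
    using sorted_nth_le_iff_less_length_filter[of "map p ?xs" k t] assms
    by (simp add: ordered_pval_def ordered_hyp_def del: upt_Suc)
qed

lemma bij_betw_ordered_hyp: "bij_betw (ordered_hyp m p) {1..m} {1..m}"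
proof -
  have "bij_betw ((!) (sort_key p [1..<Suc m])) {..<m} {1..m}"
    by (rule bij_betw_nth) (auto simp del: upt_Suc)
  moreover have "bij_betw (\<lambda>i. i - 1) {1..m} {..<m}"
    by (rule bij_betw_byWitness[where f' = Suc]) auto
  ultimately show ?thesis
    unfolding ordered_hyp_def[abs_def]
    by (auto dest: bij_betw_trans simp: o_def)
qed

lemma stepdown_indices_eq: "stepdown_indices m \<alpha> p = {1..stop_count {1..m} \<alpha> p}"
proof -
  have "(\<forall>j\<in>{1..i}. ordered_pval m p j \<le> \<alpha> j) \<longleftrightarrow> i \<le> stop_count {1..m} \<alpha> p" if "i \<le> m" for i
  proof -
    have "(\<forall>j\<in>{1..i}. ordered_pval m p j \<le> \<alpha> j) \<longleftrightarrow>
        (\<forall>k<i. ordered_pval m p (Suc k) \<le> \<alpha> (Suc k))"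
      by (metis (no_types, lifting) Suc_le_eq Suc_pred atLeastAtMost_iff One_nat_def le_add1 plus_1_eq_Suc)
    also have "\<dots> \<longleftrightarrow> i \<le> stop_count {1..m} \<alpha> p"
      using that by (simp add: le_stop_count_iff ordered_pval_le_iff)
    finally show ?thesis .
  qed
  moreover have "stop_count {1..m} \<alpha> p \<le> m"
    using stop_count_le_card[of "{1..m}" \<alpha> p] by simp
  ultimately show ?thesis
    unfolding stepdown_indices_def by fastforce
qed

lemma stepdown_rejected_eq_image:
  "stepdown_rejected m \<alpha> p = ordered_hyp m p ` {1..stop_count {1..m} \<alpha> p}"
proof (cases "stop_count {1..m} \<alpha> p = 0")
  case False
  then have "Max {1..stop_count {1..m} \<alpha> p} = stop_count {1..m} \<alpha> p"
    by (intro Max_eqI) auto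
  with False show ?thesis
    by (simp add: stepdown_rejected_def stepdown_indices_eq)
qed (simp add: stepdown_rejected_def stepdown_indices_eq)

lemma num_rejected_eq: "num_rejected m \<alpha> p = stop_count {1..m} \<alpha> p"
proof -
  have "{1..stop_count {1..m} \<alpha> p} \<subseteq> {1..m}"
    using stop_count_le_card[of "{1..m}" \<alpha> p] by simp
  then show ?thesis
    unfolding num_rejected_def stepdown_rejected_eq_image
    by (subst card_image) (auto intro: inj_on_subset[OF bij_betw_imp_inj_on[OF bij_betw_ordered_hyp]])
qed

lemma stepdown_rejected_subset: "stepdown_rejected m \<alpha> p \<subseteq> {1..m}"
proof -
  have "stop_count {1..m} \<alpha> p \<le> m"
    using stop_count_le_card[of "{1..m}" \<alpha> p] by simp
  then show ?thesis
    using bij_betw_ordered_hyp[of m p]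
    unfolding stepdown_rejected_eq_image bij_betw_def by (auto 0 3)
qed

lemma stepdown_rejected_pval_le:
  assumes "i \<in> stepdown_rejected m \<alpha> p" and mono: "mono_on {1..m} \<alpha>"
  shows "0 < stop_count {1..m} \<alpha> p" "p i \<le> \<alpha> (stop_count {1..m} \<alpha> p)"
proof -
  let ?K = "stop_count {1..m} \<alpha> p"
  have le: "?K \<le> m" using stop_count_le_card[of "{1..m}" \<alpha> p] by simp
  obtain j where j: "j \<in> {1..?K}" "i = ordered_hyp m p j"
    using assms(1) by (auto simp: stepdown_rejected_eq_image)
  then show "0 < ?K" by auto
  have "?K \<in> stepdown_indices m \<alpha> p" using j by (auto simp: stepdown_indices_eq)
  then have "ordered_pval m p j \<le> \<alpha> j" using j by (auto simp: stepdown_indices_def)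
  also have "\<dots> \<le> \<alpha> ?K" using j le by (intro mono_onD[OF mono]) auto
  finally show "p i \<le> \<alpha> ?K" by (simp add: j ordered_pval_def)
qed

section \<open>Removing one hypothesis\<close>

text \<open>
  The strict inequality keeps the index \<open>Suc U\<close> of the deciding critical value within
  \<open>{1..m}\<close>, where \<open>\<alpha>\<close> is monotone, and makes \<open>m - U\<close> positive.
\<close>

lemma stop_count_remove_less:
  assumes "i \<in> {1..m}"
  shows "stop_count ({1..m} - {i}) \<alpha> p < m"
  using stop_count_le_card[of "{1..m} - {i}" \<alpha> p] assms by auto

text \<open>
  Adding \<open>i\<close> can only increase the counts, so the full procedure also passes the first \<open>U\<close>
  steps. At step \<open>U + 1\<close>, at least \<open>U\<close> of the other p-values lie below \<open>\<alpha>\<^sub>U \<le> \<alpha>\<^sub>U\<^sub>+\<^sub>1\<close>, and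
  \<open>i\<close> supplies the missing one.
\<close>

lemma Suc_stop_count_remove_le:
  assumes i: "i \<in> {1..m}" and mono: "mono_on {1..m} \<alpha>"
    and le: "p i \<le> \<alpha> (Suc (stop_count ({1..m} - {i}) \<alpha> p))"
  shows "Suc (stop_count ({1..m} - {i}) \<alpha> p) \<le> stop_count {1..m} \<alpha> p"
proof -
  let ?U = "stop_count ({1..m} - {i}) \<alpha> p"
  let ?N = "\<lambda>J t. card {j \<in> J. p j \<le> t}"
  have Um: "?U < m" by (rule stop_count_remove_less[OF i])
  have "k < ?N {1..m} (\<alpha> (Suc k))" if "k < Suc ?U" for k
  proof (cases "k < ?U")
    case True
    then have "k < ?N ({1..m} - {i}) (\<alpha> (Suc k))" by (rule less_card_if_less_stop_count)
    also have "\<dots> \<le> ?N {1..m} (\<alpha> (Suc k))" by (rule card_mono) auto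
    finally show ?thesis .
  next
    case False
    then have k: "k = ?U" using that by simp
    have "?U \<le> ?N ({1..m} - {i}) (\<alpha> (Suc ?U))"
    proof (cases "?U = 0")
      case False
      then have "?U - 1 < ?N ({1..m} - {i}) (\<alpha> (Suc (?U - 1)))"
        by (intro less_card_if_less_stop_count) simp
      also have "\<dots> \<le> ?N ({1..m} - {i}) (\<alpha> (Suc ?U))"
      proof (rule card_mono)
        have "\<alpha> (Suc (?U - 1)) \<le> \<alpha> (Suc ?U)"
          using False Um by (intro mono_onD[OF mono]) auto
        then show "{j \<in> {1..m} - {i}. p j \<le> \<alpha> (Suc (?U - 1))} \<subseteq> {j \<in> {1..m} - {i}. p j \<le> \<alpha> (Suc ?U)}"
          by auto
      qed simp
      finally show ?thesis by simp
    qed simp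
    also have "\<dots> < ?N {1..m} (\<alpha> (Suc ?U))"
      by (rule psubset_card_mono) (use i le in auto)
    finally show ?thesis by (simp add: k)
  qed
  then show ?thesis by (subst le_stop_count_iff) auto
qed

text \<open>
  A p-value above \<open>\<alpha>\<^sub>U\<^sub>+\<^sub>1\<close> is invisible to all the counts up to step \<open>U + 1\<close>, by monotonicity
  of the critical values, so the full procedure stops at the same place as the reduced one.
\<close>

lemma stop_count_remove_eq:
  assumes i: "i \<in> {1..m}" and mono: "mono_on {1..m} \<alpha>"
    and gt: "\<alpha> (Suc (stop_count ({1..m} - {i}) \<alpha> p)) < p i"
  shows "stop_count {1..m} \<alpha> p = stop_count ({1..m} - {i}) \<alpha> p"
proof -
  let ?U = "stop_count ({1..m} - {i}) \<alpha> p"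
  have Um: "?U < m" by (rule stop_count_remove_less[OF i])
  have "{j \<in> {1..m}. p j \<le> \<alpha> (Suc k)} = {j \<in> {1..m} - {i}. p j \<le> \<alpha> (Suc k)}" if "k \<le> ?U" for k
  proof -
    have "\<alpha> (Suc k) \<le> \<alpha> (Suc ?U)" using that Um by (intro mono_onD[OF mono]) auto
    then show ?thesis using gt by auto
  qed
  then show ?thesis
    using card_le_stop_count[of "{1..m} - {i}" p \<alpha>] less_card_if_less_stop_count[of _ "{1..m} - {i}" \<alpha> p]
    by (subst stop_count_eq_iff) auto
qed

lemma not_rejected_if_gt:
  assumes i: "i \<in> {1..m}" and mono: "mono_on {1..m} \<alpha>"
    and gt: "\<alpha> (Suc (stop_count ({1..m} - {i}) \<alpha> p)) < p i"
  shows "i \<notin> stepdown_rejected m \<alpha> p"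
proof
  let ?U = "stop_count ({1..m} - {i}) \<alpha> p"
  assume "i \<in> stepdown_rejected m \<alpha> p"
  note * = stepdown_rejected_pval_le[OF this mono, unfolded stop_count_remove_eq[OF assms]]
  have "\<alpha> ?U \<le> \<alpha> (Suc ?U)"
    using *(1) stop_count_remove_less[OF i, of \<alpha> p] by (intro mono_onD[OF mono]) auto
  then show False using *(2) gt by simp
qed

section \<open>Pointwise bounds for both error proportions\<close>

text \<open>
  \<open>V / R\<close> is split into the contributions of the individual true nulls, and the denominator \<open>R\<close>
  is replaced by \<open>U i + 1\<close>, which does not involve \<open>p i\<close>.
\<close>

lemma false_discovery_proportion_le:
  fixes p :: "nat \<Rightarrow> real"
  assumes I0: "I0 \<subseteq> {1..m}" and mono: "mono_on {1..m} \<alpha>"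
  defines "U \<equiv> \<lambda>i. stop_count ({1..m} - {i}) \<alpha> p"
  shows "real (num_true_rejected m \<alpha> I0 p) / real (num_rejected m \<alpha> p)
    \<le> (\<Sum>i\<in>I0. of_bool (p i \<le> \<alpha> (Suc (U i))) / real (Suc (U i)))"
proof -
  have fin: "finite I0" using I0 finite_subset by blast
  let ?rej = "stepdown_rejected m \<alpha> p" and ?R = "num_rejected m \<alpha> p"
  have "real (num_true_rejected m \<alpha> I0 p) / real ?R = (\<Sum>i\<in>I0. of_bool (i \<in> ?rej) / real ?R)"
    using fin by (simp add: num_true_rejected_def sum_divide_distrib[symmetric] Int_commute)
  also have "\<dots> \<le> (\<Sum>i\<in>I0. of_bool (p i \<le> \<alpha> (Suc (U i))) / real (Suc (U i)))"
  proof (rule sum_mono)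
    fix i assume "i \<in> I0"
    then have i: "i \<in> {1..m}" using I0 by auto
    show "of_bool (i \<in> ?rej) / real ?R \<le> of_bool (p i \<le> \<alpha> (Suc (U i))) / real (Suc (U i))"
    proof (cases "p i \<le> \<alpha> (Suc (U i))")
      case True
      then have "Suc (U i) \<le> ?R"
        unfolding U_def num_rejected_eq by (rule Suc_stop_count_remove_le[OF i mono])
      then show ?thesis using True by (auto intro!: divide_left_mono)
    next
      case False
      then have "i \<notin> ?rej"
        using not_rejected_if_gt[OF i mono] by (simp add: U_def)
      then show ?thesis by simp
    qed
  qed
  finally show ?thesis .
qed

text \<open>
  The dual of the previous bound: on the event in the \<open>i\<close>-th summand, \<open>U i\<close> is the number of
  rejections and \<open>i\<close> is accepted, so the sum is at most the proportion of true nulls among the accepted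
  hypotheses. If everything is rejected, that proportion is \<open>0 / 0 = 0\<close>.
\<close>

lemma accepted_true_null_proportion_le:
  fixes p :: "nat \<Rightarrow> real"
  assumes I0: "I0 \<subseteq> {1..m}" and mono: "mono_on {1..m} \<alpha>"
  defines "U \<equiv> \<lambda>i. stop_count ({1..m} - {i}) \<alpha> p"
  shows "(\<Sum>i\<in>I0. of_bool (\<alpha> (Suc (U i)) < p i) / (real m - real (U i))) \<le> 1"
proof -
  have fin: "finite I0" using I0 finite_subset by blast
  let ?rej = "stepdown_rejected m \<alpha> p" and ?R = "num_rejected m \<alpha> p"
  have R: "card ({1..m} - ?rej) = m - ?R" "?R \<le> m"
    using card_Diff_subset[of ?rej "{1..m}"] stepdown_rejected_subset[of m \<alpha> p]
      card_mono[of "{1..m}" ?rej] finite_subset[of ?rej "{1..m}"]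
    by (auto simp: num_rejected_def)
  have "(\<Sum>i\<in>I0. of_bool (\<alpha> (Suc (U i)) < p i) / (real m - real (U i)))
      \<le> (\<Sum>i\<in>I0. of_bool (i \<notin> ?rej) / (real m - real ?R))"
  proof (rule sum_mono)
    fix i assume "i \<in> I0"
    then have i: "i \<in> {1..m}" using I0 by auto
    show "of_bool (\<alpha> (Suc (U i)) < p i) / (real m - real (U i))
      \<le> of_bool (i \<notin> ?rej) / (real m - real ?R)"
      using not_rejected_if_gt[OF i mono, of p] stop_count_remove_eq[OF i mono, of p] R
      by (auto simp: U_def num_rejected_eq)
  qed
  also have "\<dots> = real (card (I0 - ?rej)) / real (card ({1..m} - ?rej))"
    using fin R by (simp add: sum_divide_distrib[symmetric] of_nat_diff Diff_eq Compl_eq Int_commute)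
  also have "\<dots> \<le> 1"
  proof -
    have "real x / real y \<le> 1" if "x \<le> y" for x y :: nat
      using that by (cases "y = 0") simp_all
    moreover have "card (I0 - ?rej) \<le> card ({1..m} - ?rej)"
      using I0 by (intro card_mono) auto
    ultimately show ?thesis by blast
  qed
  finally show ?thesis .
qed

section \<open>Integrating out one p-value\<close>

lemma prob_uniform_le:
  assumes "X \<in> borel_measurable M"
    and "distr M borel X = uniform_measure lborel {0..1::real}" and "0 \<le> t" "t \<le> 1"
  shows "measure M {\<omega> \<in> space M. X \<omega> \<le> t} = t"
proof -
  have "measure M {\<omega> \<in> space M. X \<omega> \<le> t} = measure (distr M borel X) {..t}"
    using assms(1) by (subst measure_distr) (auto intro!: arg_cong[where f = "measure M"])
  also have "\<dots> = measure lborel ({0..1} \<inter> {..t}) / measure lborel {0..1::real}"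
    unfolding assms(2) by (rule measure_uniform_measure) auto
  also have "{0..1} \<inter> {..t} = {0..t}"
    using assms by auto
  finally show ?thesis using assms by simp
qed

text \<open>
  Conditionally on \<open>T\<close>, the event \<open>X \<le> a T\<close> has probability \<open>a T\<close>. As \<open>T\<close> takes finitely many
  values, all expectations are finite sums over its level sets, and independence is applied on
  each of them. Independence is stated for \<open>real \<circ> T\<close> because \<open>indep_var\<close> relates two variables
  with the same type of values.
\<close>

lemma (in prob_space) expectation_below_independent_threshold:
  fixes X :: "'a \<Rightarrow> real" and T :: "'a \<Rightarrow> nat"
  assumes indep: "indep_var borel X borel (\<lambda>\<omega>. real (T \<omega>))"
    and bound: "\<And>\<omega>. \<omega> \<in> space M \<Longrightarrow> T \<omega> < m"
    and unif: "distr M borel X = uniform_measure lborel {0..1}"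
    and a: "\<And>u. u < m \<Longrightarrow> 0 \<le> a u \<and> a u \<le> 1"
  shows "integrable M (\<lambda>\<omega>. h (T \<omega>) :: real)"
    and "integrable M (\<lambda>\<omega>. of_bool (X \<omega> \<le> a (T \<omega>)) * h (T \<omega>))"
    and "expectation (\<lambda>\<omega>. of_bool (X \<omega> \<le> a (T \<omega>)) * h (T \<omega>)) = expectation (\<lambda>\<omega>. a (T \<omega>) * h (T \<omega>))"
proof -
  have [measurable]: "X \<in> borel_measurable M" "(\<lambda>\<omega>. real (T \<omega>)) \<in> borel_measurable M"
    using indep_var_rv1[OF indep] indep_var_rv2[OF indep] by auto
  have "(\<lambda>\<omega>. nat \<lfloor>real (T \<omega>)\<rfloor>) \<in> measurable M (count_space UNIV)"
    by measurable
  then have [measurable]: "T \<in> measurable M (count_space UNIV)"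
    by simp
  let ?T = "\<lambda>u. {\<omega> \<in> space M. T \<omega> = u}"
  let ?XT = "\<lambda>u. {\<omega> \<in> space M. X \<omega> \<le> a u \<and> T \<omega> = u}"
  have expand: "g (T \<omega>) = (\<Sum>u<m. g u * indicator (?T u) \<omega>)" if "\<omega> \<in> space M" for g :: "nat \<Rightarrow> real" and \<omega>
    using that bound[OF that] by (simp add: indicator_def if_distrib cong: if_cong)
  have expandX: "of_bool (X \<omega> \<le> a (T \<omega>)) * h (T \<omega>) = (\<Sum>u<m. h u * indicator (?XT u) \<omega>)"
    if "\<omega> \<in> space M" for \<omega>
  proof -
    have "of_bool (X \<omega> \<le> a (T \<omega>)) * h (T \<omega>) = (\<Sum>u<m. (of_bool (X \<omega> \<le> a u) * h u) * indicator (?T u) \<omega>)"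
      using expand[OF that, of "\<lambda>u. of_bool (X \<omega> \<le> a u) * h u"] .
    also have "\<dots> = (\<Sum>u<m. h u * indicator (?XT u) \<omega>)"
      by (intro sum.cong) (auto simp: indicator_def)
    finally show ?thesis .
  qed
  have int: "integrable M (\<lambda>\<omega>. g (T \<omega>))" and E: "expectation (\<lambda>\<omega>. g (T \<omega>)) = (\<Sum>u<m. g u * prob (?T u))"
    for g :: "nat \<Rightarrow> real"
  proof -
    have "integrable M (\<lambda>\<omega>. \<Sum>u<m. g u * indicator (?T u) \<omega>)"
      by (intro Bochner_Integration.integrable_sum integrable_mult_right integrable_real_indicator)
         (measurable, simp add: emeasure_eq_measure)
    then show "integrable M (\<lambda>\<omega>. g (T \<omega>))"
      by (subst Bochner_Integration.integrable_cong[OF refl expand])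
    have "expectation (\<lambda>\<omega>. g (T \<omega>)) = expectation (\<lambda>\<omega>. \<Sum>u<m. g u * indicator (?T u) \<omega>)"
      by (rule Bochner_Integration.integral_cong[OF refl expand])
    also have "\<dots> = (\<Sum>u<m. g u * prob (?T u))"
      by (subst Bochner_Integration.integral_sum) (auto simp: less_top[symmetric])
    finally show "expectation (\<lambda>\<omega>. g (T \<omega>)) = (\<Sum>u<m. g u * prob (?T u))" .
  qed
  show "integrable M (\<lambda>\<omega>. h (T \<omega>))" by (rule int)
  have "integrable M (\<lambda>\<omega>. \<Sum>u<m. h u * indicator (?XT u) \<omega>)"
    by (intro Bochner_Integration.integrable_sum integrable_mult_right integrable_real_indicator)
       (measurable, simp add: emeasure_eq_measure)
  then show "integrable M (\<lambda>\<omega>. of_bool (X \<omega> \<le> a (T \<omega>)) * h (T \<omega>))"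
    by (subst Bochner_Integration.integrable_cong[OF refl expandX])
  have prod: "prob (?XT u) = a u * prob (?T u)" if "u < m" for u
  proof -
    have "prob ((\<lambda>\<omega>. (X \<omega>, real (T \<omega>))) -` ({..a u} \<times> {real u}) \<inter> space M)
        = prob (X -` {..a u} \<inter> space M) * prob ((\<lambda>\<omega>. real (T \<omega>)) -` {real u} \<inter> space M)"
      by (rule indep_varD[OF indep]) auto
    moreover have "(\<lambda>\<omega>. (X \<omega>, real (T \<omega>))) -` ({..a u} \<times> {real u}) \<inter> space M = ?XT u"
      "X -` {..a u} \<inter> space M = {\<omega> \<in> space M. X \<omega> \<le> a u}" "(\<lambda>\<omega>. real (T \<omega>)) -` {real u} \<inter> space M = ?T u" by auto
    ultimately show ?thesis
      using prob_uniform_le[OF _ unif, of "a u"] a[OF that] by simp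
  qed
  have "expectation (\<lambda>\<omega>. of_bool (X \<omega> \<le> a (T \<omega>)) * h (T \<omega>)) = expectation (\<lambda>\<omega>. \<Sum>u<m. h u * indicator (?XT u) \<omega>)"
    by (rule Bochner_Integration.integral_cong[OF refl expandX])
  also have "\<dots> = (\<Sum>u<m. h u * prob (?XT u))"
    by (subst Bochner_Integration.integral_sum) (auto simp: less_top[symmetric])
  also have "\<dots> = (\<Sum>u<m. (a u * h u) * prob (?T u))"
    by (intro sum.cong) (auto simp: prod)
  also have "\<dots> = expectation (\<lambda>\<omega>. a (T \<omega>) * h (T \<omega>))"
    by (rule E[symmetric, of "\<lambda>u. a u * h u"])
  finally show "expectation (\<lambda>\<omega>. of_bool (X \<omega> \<le> a (T \<omega>)) * h (T \<omega>)) = expectation (\<lambda>\<omega>. a (T \<omega>) * h (T \<omega>))" .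
qed

lemma measurable_stop_count:
  assumes "finite J"
  shows "stop_count J \<alpha> \<in> measurable (PiM J (\<lambda>_. borel)) (count_space UNIV)"
proof -
  \<comment> \<open>As a finite sum, the cardinality is within reach of the automatic measurability rules.\<close>
  have card_eq: "card {j \<in> J. f j \<le> t} = (\<Sum>j\<in>J. of_bool (f j \<le> t))" for f and t :: real
    using assms by (simp add: Collect_conj_eq)
  show ?thesis
    unfolding stop_count_def[abs_def] card_eq using assms by measurable
qed

lemma (in prob_space) indep_var_stop_count_remove:
  assumes "finite J" "i \<in> J" "indep_vars (\<lambda>_. borel) P J"
  shows "indep_var borel (P i) borel (\<lambda>\<omega>. real (stop_count (J - {i}) \<alpha> (\<lambda>j. P j \<omega>)))"
proof -
  have "indep_var (PiM {i} (\<lambda>_. borel)) (\<lambda>\<omega>. \<lambda>j\<in>{i}. P j \<omega>)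
      (PiM (J - {i}) (\<lambda>_. borel)) (\<lambda>\<omega>. \<lambda>j\<in>J - {i}. P j \<omega>)"
    by (rule indep_var_restrict[OF assms(3)]) (use assms in auto)
  then have "indep_var borel ((\<lambda>f. f i) \<circ> (\<lambda>\<omega>. \<lambda>j\<in>{i}. P j \<omega>))
      borel ((\<lambda>f. real (stop_count (J - {i}) \<alpha> f)) \<circ> (\<lambda>\<omega>. \<lambda>j\<in>J - {i}. P j \<omega>))"
    by (rule indep_var_compose) (use assms in \<open>auto intro!: measurable_compose[OF measurable_stop_count]\<close>)
  moreover have "stop_count (J - {i}) \<alpha> (\<lambda>j\<in>J - {i}. P j \<omega>) = stop_count (J - {i}) \<alpha> (\<lambda>j. P j \<omega>)" for \<omega>
    unfolding stop_count_def by (simp cong: conj_cong)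
  ultimately show ?thesis by (simp add: o_def)
qed

section \<open>Control of the false discovery rate\<close>

theorem theorem1p1:
  fixes M :: "'a measure"
    and m :: nat
    and q :: real
    and I0 :: "nat set"
    and P :: "nat \<Rightarrow> 'a \<Rightarrow> real"
    and \<alpha> :: "nat \<Rightarrow> real"
  assumes "prob_space M"
    and "m \<ge> 1"
    and "0 < q" and "q < 1"
    and "I0 \<subseteq> {1..m}"
    and "\<And>i \<omega>. i \<in> {1..m} \<Longrightarrow> \<omega> \<in> space M \<Longrightarrow> P i \<omega> \<in> {0..1}"
    and "prob_space.indep_vars M (\<lambda>_. borel) P {1..m}"
    and "\<And>i. i \<in> I0 \<Longrightarrow> distr M borel (P i) = uniform_measure lborel {0..1}"
    and "0 \<le> \<alpha> 1" and "mono_on {1..m} \<alpha>" and "\<alpha> m < 1"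
    and "\<And>i. i \<in> {1..m} \<Longrightarrow>
           \<alpha> i / (1 - \<alpha> i) \<le> real i * q / (real m + 1 - real i)"
  shows "stepdown_FDR M m \<alpha> I0 P \<le> q"
proof -
  interpret prob_space M by fact
  note I0 = \<open>I0 \<subseteq> {1..m}\<close> and mono = \<open>mono_on {1..m} \<alpha>\<close>
  define U where "U i \<omega> = stop_count ({1..m} - {i}) \<alpha> (\<lambda>j. P j \<omega>)" for i \<omega>
  define a where "a u = \<alpha> (Suc u)" for u
  \<comment> \<open>The shares of \<open>i\<close> in the proportions of true nulls among the rejected and among the
    accepted hypotheses, with \<open>R\<close> replaced by \<open>U i + 1\<close> and by \<open>U i\<close>, respectively.\<close>
  define rej where "rej i \<omega> = of_bool (P i \<omega> \<le> a (U i \<omega>)) * (1 / real (Suc (U i \<omega>)))" for i \<omega>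
  define acc where "acc i \<omega> = of_bool (a (U i \<omega>) < P i \<omega>) * (1 / (real m - real (U i \<omega>)))" for i \<omega>
  have a: "0 \<le> a u" "a u < 1" if "u < m" for u
    using mono_onD[OF mono, of 1 "Suc u"] mono_onD[OF mono, of "Suc u" m] that
      \<open>0 \<le> \<alpha> 1\<close> \<open>\<alpha> m < 1\<close> by (auto simp: a_def)
  \<comment> \<open>The hypothesis on the critical values at index \<open>u + 1\<close>, rearranged to compare
    the shares in the two proportions.\<close>
  have crit: "a u * (1 / real (Suc u)) \<le> q * ((1 - a u) * (1 / (real m - real u)))" if "u < m" for u
    using assms(12)[of "Suc u"] a[OF that] that
    by (simp add: a_def[symmetric] field_simps)
  have U_less: "U i \<omega> < m" if "i \<in> I0" for i \<omega>
    unfolding U_def using that I0 by (intro stop_count_remove_less) auto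
  have int: "integrable M (rej i)" "integrable M (acc i)"
    and le: "expectation (rej i) \<le> q * expectation (acc i)" if i: "i \<in> I0" for i
  proof -
    have indep: "indep_var borel (P i) borel (\<lambda>\<omega>. real (U i \<omega>))"
      unfolding U_def[abs_def] using assms(7) i I0
      by (intro indep_var_stop_count_remove) auto
    have a': "0 \<le> a u \<and> a u \<le> 1" if "u < m" for u using a[OF that] by simp
    note thr = expectation_below_independent_threshold[where a = a and m = m, OF indep U_less[OF i] assms(8)[OF i] a']
    \<comment> \<open>\<open>P i > a (U i)\<close> is turned into the complement of the event treated by \<open>thr\<close>.\<close>
    have acc_eq: "acc i = (\<lambda>\<omega>. 1 / (real m - real (U i \<omega>))
        - of_bool (P i \<omega> \<le> a (U i \<omega>)) * (1 / (real m - real (U i \<omega>))))"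
      by (auto simp: acc_def fun_eq_iff)
    show "integrable M (rej i)"
      unfolding rej_def[abs_def] by (rule thr(2)[where h = "\<lambda>u. 1 / real (Suc u)"])
    show "integrable M (acc i)"
      unfolding acc_eq
      using thr(1,2)[where h = "\<lambda>u. 1 / (real m - real u)"] by (rule Bochner_Integration.integrable_diff)
    have int_T: "integrable M (\<lambda>\<omega>. h (U i \<omega>))" for h :: "nat \<Rightarrow> real" by (rule thr(1))
    have "expectation (rej i) = expectation (\<lambda>\<omega>. a (U i \<omega>) * (1 / real (Suc (U i \<omega>))))"
      unfolding rej_def[abs_def] by (rule thr(3)[where h = "\<lambda>u. 1 / real (Suc u)"])
    also have "\<dots> \<le> expectation (\<lambda>\<omega>. q * ((1 - a (U i \<omega>)) * (1 / (real m - real (U i \<omega>)))))"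
      by (intro integral_mono crit U_less i
          int_T[of "\<lambda>u. a u * (1 / real (Suc u))"]
          int_T[of "\<lambda>u. q * ((1 - a u) * (1 / (real m - real u)))"])
    also have "\<dots> = q * expectation (\<lambda>\<omega>. (1 - a (U i \<omega>)) * (1 / (real m - real (U i \<omega>))))"
      by (rule integral_mult_right_zero)
    also have "expectation (\<lambda>\<omega>. (1 - a (U i \<omega>)) * (1 / (real m - real (U i \<omega>))))
        = expectation (\<lambda>\<omega>. 1 / (real m - real (U i \<omega>)))
          - expectation (\<lambda>\<omega>. a (U i \<omega>) * (1 / (real m - real (U i \<omega>))))"
      unfolding left_diff_distrib mult_1
      by (intro Bochner_Integration.integral_diff
          int_T[of "\<lambda>u. 1 / (real m - real u)"] int_T[of "\<lambda>u. a u * (1 / (real m - real u))"])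
    also have "\<dots> = expectation (acc i)"
      unfolding acc_eq
      by (subst Bochner_Integration.integral_diff)
         (use thr[where h = "\<lambda>u. 1 / (real m - real u)"] in auto)
    finally show "expectation (rej i) \<le> q * expectation (acc i)" .
  qed
  have "stepdown_FDR M m \<alpha> I0 P \<le> expectation (\<lambda>\<omega>. \<Sum>i\<in>I0. rej i \<omega>)"
    unfolding stepdown_FDR_def Let_def
  \<comment> \<open>A nonnegative integrable upper bound suffices: were the proportion not measurable, its
    integral would be \<open>0\<close>.\<close>
  proof (rule integral_mono')
    show "integrable M (\<lambda>\<omega>. \<Sum>i\<in>I0. rej i \<omega>)" using int by auto
    show nonneg: "0 \<le> (\<Sum>i\<in>I0. rej i \<omega>)" for \<omega>
      by (intro sum_nonneg) (simp add: rej_def)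
    show "(if 0 < num_rejected m \<alpha> (\<lambda>i. P i \<omega>)
        then real (num_true_rejected m \<alpha> I0 (\<lambda>i. P i \<omega>)) / real (num_rejected m \<alpha> (\<lambda>i. P i \<omega>)) else 0)
        \<le> (\<Sum>i\<in>I0. rej i \<omega>)" for \<omega>
      using false_discovery_proportion_le[OF I0 mono, of "\<lambda>i. P i \<omega>"] nonneg[of \<omega>]
      by (simp add: rej_def a_def U_def)
  qed
  also have "\<dots> = (\<Sum>i\<in>I0. expectation (rej i))"
    using int by simp
  also have "\<dots> \<le> (\<Sum>i\<in>I0. q * expectation (acc i))"
    by (intro sum_mono le)
  also have "\<dots> = q * expectation (\<lambda>\<omega>. \<Sum>i\<in>I0. acc i \<omega>)"
    using int by (simp add: sum_distrib_left)
  also have "expectation (\<lambda>\<omega>. \<Sum>i\<in>I0. acc i \<omega>) \<le> 1"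
  proof (rule integral_le_const)
    show "integrable M (\<lambda>\<omega>. \<Sum>i\<in>I0. acc i \<omega>)" using int by auto
    show "AE \<omega> in M. (\<Sum>i\<in>I0. acc i \<omega>) \<le> 1"
      using accepted_true_null_proportion_le[OF I0 mono]
      by (intro AE_I2) (simp add: acc_def a_def U_def)
  qed
  finally show ?thesis using \<open>0 < q\<close> by simp
qed

end
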